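(* For each $m\ge1$, let $X_m=s_m+N_m$, where $X_m,s_m,N_m$ are $p_m$-dimensional real vectors, $s_m$ is deterministic, and the random vector $N_m$ has a spherical distribution. Let $\Theta_{m1}\subset\mathbb R^{p_m}$. Consider the randomization tests of the null hypotheses $s_m=0$ with statistics $\|X_m\|_\infty$ and randomization distributions uniform over the orthogonal group $O(p_m)$. As $m\to\infty$, the sequence of randomization tests is consistent against the sequence of alternatives with $s_m\in\Theta_{m1}$ if there is a sequence $(t_{m,2})_{m\ge1}$ such that with probability tending to unity $\|N_m\|_2\le t_{m,2}$, and for any sequence $(s_m)_{m\ge1}$ with $s_m\in\Theta_{m1}$ for all $m\ge 1$, $$\liminf_{m\to\infty}\frac{\|s_m\|_\infty/(2\log p_m)^{1/2}}{(\|s_m\|_2+2t_{m,2})/p_m^{1/2}}>1.$$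
   Context: A random vector $N\in\mathbb R^p$ has a spherical distribution if $ON=_dN$ (equality in distribution) for every orthogonal matrix $O\in O(p)$. Randomization test: given a statistic $f_m$, a fixed $\alpha\in(0,1]$, an integer $K\ge1$, and a compact group acting linearly on the data, draw $G_{m1},\dots,G_{mK}$ iid from the Haar probability measure on the group, independently of the data; let $f_{(1)}\le\dots\le f_{(K+1)}$ be the ordered values of $f_m(X_m),f_m(G_{m1}X_m),\dots,f_m(G_{mK}X_m)$ and $k=\lceil(1-\alpha)(K+1)\rceil$; reject when $f_m(X_m)>f_{(k)}$ (with $f_{(0)}=-\infty$, relevant only if $\alpha=1$). Here $O(p_m)$ acts on $\mathbb R^{p_m}$ by matrix-vector multiplication. Consistent against $s_m\in\Theta_{m1}$ means: for every sequence $(s_m)_{m\ge1}$ with $s_m\in\Theta_{m1}$ for all $m$, the rejection probability (over the noise and the random group elements) tends to $1$ as $m\to\infty$.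
   Formalization: The formal theorem additionally assumes that p_m tends to infinity and that α(K+1) ≥ 1; with bounded p_m the claim can fail (e.g. p_m = 2, small noise), and if α(K+1) < 1 the test never rejects. *)

theory Defs
  imports "HOL-Probability.Probability"
begin

text \<open>
  The dimension varies with the index of the sequence, so a vector of dimension \<open>p\<close> is an
  extensional function on \<open>{..<p}\<close> and a \<open>p \<times> p\<close> matrix is an extensional function on
  \<open>{..<p} \<times> {..<p}\<close>. The finite product sigma-algebras below are the Borel sigma-algebras.
\<close>

definition rvec :: "nat \<Rightarrow> (nat \<Rightarrow> real) measure" where
  "rvec p = PiM {..<p} (\<lambda>_. borel)"

definition rmat :: "nat \<Rightarrow> (nat \<times> nat \<Rightarrow> real) measure" where
  "rmat p = PiM ({..<p} \<times> {..<p}) (\<lambda>_. borel)"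

definition vec_add :: "nat \<Rightarrow> (nat \<Rightarrow> real) \<Rightarrow> (nat \<Rightarrow> real) \<Rightarrow> nat \<Rightarrow> real" where
  "vec_add p x y = (\<lambda>i\<in>{..<p}. x i + y i)"

definition mat_vec :: "nat \<Rightarrow> (nat \<times> nat \<Rightarrow> real) \<Rightarrow> (nat \<Rightarrow> real) \<Rightarrow> nat \<Rightarrow> real" where
  "mat_vec p A x = (\<lambda>i\<in>{..<p}. \<Sum>j<p. A (i, j) * x j)"

definition mat_mul ::
  "nat \<Rightarrow> (nat \<times> nat \<Rightarrow> real) \<Rightarrow> (nat \<times> nat \<Rightarrow> real) \<Rightarrow> nat \<times> nat \<Rightarrow> real" where
  "mat_mul p A B = (\<lambda>(i, j)\<in>{..<p} \<times> {..<p}. \<Sum>k<p. A (i, k) * B (k, j))"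

definition mat_transpose :: "nat \<Rightarrow> (nat \<times> nat \<Rightarrow> real) \<Rightarrow> nat \<times> nat \<Rightarrow> real" where
  "mat_transpose p A = (\<lambda>(i, j)\<in>{..<p} \<times> {..<p}. A (j, i))"

definition mat_id :: "nat \<Rightarrow> nat \<times> nat \<Rightarrow> real" where
  "mat_id p = (\<lambda>(i, j)\<in>{..<p} \<times> {..<p}. if i = j then 1 else 0)"

definition orthogonal_group :: "nat \<Rightarrow> (nat \<times> nat \<Rightarrow> real) set" where
  "orthogonal_group p = {A \<in> space (rmat p). mat_mul p (mat_transpose p A) A = mat_id p}"

definition orth_space :: "nat \<Rightarrow> (nat \<times> nat \<Rightarrow> real) measure" where
  "orth_space p = restrict_space (rmat p) (orthogonal_group p)"

definition l2_norm :: "nat \<Rightarrow> (nat \<Rightarrow> real) \<Rightarrow> real" where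
  "l2_norm p x = L2_set x {..<p}"

definition linf_norm :: "nat \<Rightarrow> (nat \<Rightarrow> real) \<Rightarrow> real" where
  "linf_norm p x = Max ((\<lambda>i. \<bar>x i\<bar>) ` {..<p})"

definition spherical :: "nat \<Rightarrow> 'a measure \<Rightarrow> ('a \<Rightarrow> nat \<Rightarrow> real) \<Rightarrow> bool" where
  "spherical p M N \<longleftrightarrow>
     N \<in> M \<rightarrow>\<^sub>M rvec p \<and>
     (\<forall>Q\<in>orthogonal_group p. distr M (rvec p) (\<lambda>\<omega>. mat_vec p Q (N \<omega>)) = distr M (rvec p) N)"

text \<open>
  The left-invariant Borel probability measure on the orthogonal group. By the classical
  theory of compact groups there is exactly one, and it is also right-invariant.
\<close>

definition haar_prob :: "nat \<Rightarrow> (nat \<times> nat \<Rightarrow> real) measure \<Rightarrow> bool" where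
  "haar_prob p \<mu> \<longleftrightarrow>
     prob_space \<mu> \<and> sets \<mu> = sets (orth_space p) \<and>
     (\<forall>Q\<in>orthogonal_group p. distr \<mu> (orth_space p) (mat_mul p Q) = \<mu>)"

text \<open>
  The joint independence of the noise and the draws is expressed as mutual independence of
  the draws together with independence of the noise from the whole tuple of draws, because
  the noise and the draws have different types (the library's \<open>indep_var\<close> needs a common one).
\<close>

definition iid_draws ::
  "nat \<Rightarrow> nat \<Rightarrow> (nat \<times> nat \<Rightarrow> real) measure \<Rightarrow> 'a measure \<Rightarrow> ('a \<Rightarrow> nat \<Rightarrow> real) \<Rightarrow>
    (nat \<Rightarrow> 'a \<Rightarrow> nat \<times> nat \<Rightarrow> real) \<Rightarrow> bool" where
  "iid_draws p K \<mu> M N G \<longleftrightarrow>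
     (\<forall>j\<in>{1..K}. G j \<in> M \<rightarrow>\<^sub>M orth_space p \<and> distr M (orth_space p) (G j) = \<mu>) \<and>
     prob_space.indep_vars M (\<lambda>_. orth_space p) G {1..K} \<and>
     prob_space.indep_set M
       {N -` A \<inter> space M | A. A \<in> sets (rvec p)}
       {(\<lambda>\<omega>. \<lambda>j\<in>{1..K}. G j \<omega>) -` B \<inter> space M | B. B \<in> sets (PiM {1..K} (\<lambda>_. orth_space p))}"

text \<open>Order statistics are numbered from 1, with the convention that the one numbered 0 is \<open>-\<infinity>\<close>.\<close>

definition order_stat :: "real list \<Rightarrow> nat \<Rightarrow> ereal" where
  "order_stat xs k = (if k = 0 then -\<infinity> else ereal (sort xs ! (k - 1)))"

definition randomization_rejects ::
  "real \<Rightarrow> nat \<Rightarrow> ('x \<Rightarrow> real) \<Rightarrow> ('g \<Rightarrow> 'x \<Rightarrow> 'x) \<Rightarrow> (nat \<Rightarrow> 'g) \<Rightarrow> 'x \<Rightarrow> bool" where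
  "randomization_rejects \<alpha> K f act g x \<longleftrightarrow>
     ereal (f x) >
       order_stat (f x # map (\<lambda>j. f (act (g j) x)) [1..<Suc K])
         (nat \<lceil>(1 - \<alpha>) * (real K + 1)\<rceil>)"

definition consistent_against ::
  "(nat \<Rightarrow> 'a measure) \<Rightarrow> (nat \<Rightarrow> 's \<Rightarrow> 'a \<Rightarrow> bool) \<Rightarrow> (nat \<Rightarrow> 's set) \<Rightarrow> bool" where
  "consistent_against M rejects \<Theta> \<longleftrightarrow>
     (\<forall>s. (\<forall>m. s m \<in> \<Theta> m) \<longrightarrow>
        (\<lambda>m. measure (M m) {\<omega> \<in> space (M m). rejects m (s m) \<omega>}) \<longlonglongrightarrow> 1)"

end

theory Submission
  imports Defs
begin

text \<open>
  On the event that \<open>l2_norm p N \<le> t\<close>, the test rejects as soon as \<open>linf_norm p s\<close> exceeds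
  \<open>a * (l2_norm p s + 2 * t)\<close> and neither the noise \<open>N\<close> nor any rotated observation \<open>G j X\<close> has a
  sup norm greater than \<open>a\<close> times its Euclidean norm. All of these vectors are spherical (the
  rotated ones conditionally on \<open>X\<close>), so it suffices to show that a spherical vector violates
  the bound with probability at most \<open>2 * p * exp (- p * a\<^sup>2 / 2)\<close>, which tends to 0 for
  \<open>a = c * sqrt (2 * ln p / p)\<close> with \<open>c > 1\<close>. That tail bound follows from the sub-Gaussian estimate
  \<open>E exp (l * (v \<bullet> Y) / norm Y) \<le> exp (l\<^sup>2 / 2)\<close> for vectors \<open>v\<close> of length \<open>sqrt p\<close>: by
  sphericity the left-hand side does not depend on \<open>v\<close>, hence equals its average over all sign
  vectors \<open>v\<close>, and this average is the expectation of a product of hyperbolic cosines.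
\<close>

subsection \<open>Orthogonal matrices\<close>

text \<open>For \<open>x \<ge> 0\<close> this is Hoeffding's estimate for a two-point variable with
  probability \<open>1 / 2\<close> and spread \<open>2 * x\<close>, where the left-hand side
  simplifies to \<open>ln (cosh x)\<close>. Negative \<open>x\<close> follows because
  \<open>cosh\<close> is even.\<close>

lemma cosh_le_exp_half_square: "cosh x \<le> exp (x\<^sup>2 / 2)" for x :: real
proof -
  have *: "cosh x \<le> exp (x\<^sup>2 / 2)" if "x \<ge> 0" for x :: real
  proof -
    have "1 + 1 / 2 * (exp (2 * x) - 1) = exp x * cosh x"
      by (simp add: cosh_field_def field_simps flip: exp_add)
    then have "ln (cosh x) \<le> x\<^sup>2 / 2"
      using Hoeffdings_lemma_aux[of "2 * x" "1 / 2"] that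
      by (simp add: ln_mult power_mult_distrib)
    then show ?thesis
      by (metis cosh_real_pos exp_le_cancel_iff exp_ln)
  qed
  show ?thesis
    using *[of x] *[of "- x"] by (cases "x \<ge> 0") auto
qed

text \<open>The Householder reflection in the hyperplane orthogonal to \<open>d\<close>. If
  \<open>d\<close> vanishes below \<open>p\<close>, division by zero yields 0 and the matrix is the
  identity.\<close>

definition reflection :: "nat \<Rightarrow> (nat \<Rightarrow> real) \<Rightarrow> nat \<times> nat \<Rightarrow> real" where
  "reflection p d = (\<lambda>(i, j)\<in>{..<p} \<times> {..<p}.
     (if i = j then 1 else 0) - 2 * d i * d j / (\<Sum>k<p. (d k)\<^sup>2))"

lemma orthogonal_group_iff:
  "A \<in> orthogonal_group p \<longleftrightarrow> A \<in> space (rmat p) \<and>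
     (\<forall>i<p. \<forall>j<p. (\<Sum>k<p. A (k, i) * A (k, j)) = (if i = j then 1 else 0))"
proof -
  have "mat_mul p (mat_transpose p A) A = mat_id p \<longleftrightarrow>
     (\<forall>i<p. \<forall>j<p. (\<Sum>k<p. A (k, i) * A (k, j)) = (if i = j then 1 else 0))"
    unfolding mat_mul_def mat_id_def mat_transpose_def
    by (auto simp: fun_eq_iff restrict_def)
  then show ?thesis
    by (auto simp: orthogonal_group_def)
qed

lemma reflection_orthogonal: "reflection p d \<in> orthogonal_group p"
proof -
  define S where "S = (\<Sum>k<p. (d k)\<^sup>2)"
  define c where "c = 2 / S"
  \<comment> \<open>This identity makes the rank-one terms cancel when the product of the reflection
    with itself is expanded. It survives \<open>S = 0\<close>, where
    \<open>c = 2 / 0 = 0\<close>.\<close>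
  have c: "c * c * S = 2 * c"
    by (cases "S = 0") (auto simp: c_def)
  have "(\<Sum>k<p. reflection p d (k, i) * reflection p d (k, j)) = (if i = j then 1 else 0)"
    if ij: "i < p" "j < p" for i j
  proof -
    have refl_eq: "reflection p d (k, l) = (if k = l then 1 else 0) - c * d k * d l"
      if "k < p" "l < p" for k l
      using that by (simp add: reflection_def c_def S_def)
    have "(\<Sum>k<p. reflection p d (k, i) * reflection p d (k, j)) =
      (\<Sum>k<p. (if k = i then if k = j then 1 else 0 else 0)
         - (if k = i then c * d k * d j else 0) - (if k = j then c * d k * d i else 0)
         + c * c * d i * d j * (d k)\<^sup>2)"
      using ij by (intro sum.cong)
        (auto simp: refl_eq algebra_simps power2_eq_square)
    also have "\<dots> = (\<Sum>k<p. (if k = i then if k = j then 1 else 0 else 0))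
         - c * d i * d j - c * d j * d i + (c * c * S) * d i * d j"
      using ij by (simp add: sum.distrib sum_subtractf sum_distrib_left[symmetric] S_def algebra_simps)
    also have "\<dots> = (if i = j then 1 else 0)"
      unfolding c using ij by simp
    finally show ?thesis .
  qed
  moreover have "reflection p d \<in> space (rmat p)"
    by (auto simp: rmat_def reflection_def space_PiM)
  ultimately show ?thesis
    by (simp add: orthogonal_group_iff)
qed

text \<open>The reflection along \<open>u - w\<close> interchanges two vectors of equal length.
  Being symmetric, it can be moved from \<open>y\<close> onto \<open>w\<close>, which it turns into
  \<open>u\<close>.\<close>

lemma ex_orthogonal_inner:
  assumes "(\<Sum>i<p. (u i)\<^sup>2) = (\<Sum>i<p. (w i)\<^sup>2)"
  shows "\<exists>Q\<in>orthogonal_group p. \<forall>y. (\<Sum>i<p. w i * mat_vec p Q y i) = (\<Sum>i<p. u i * y i)"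
proof (intro bexI allI)
  fix y :: "nat \<Rightarrow> real"
  define d where "d = (\<lambda>i. u i - w i)"
  define S where "S = (\<Sum>k<p. (d k)\<^sup>2)"
  define T where "T = (\<Sum>i<p. w i * d i)"
  \<comment> \<open>The equality of the lengths of \<open>u\<close> and \<open>w\<close> enters
    here.\<close>
  have S: "S = - 2 * T"
    using assms unfolding S_def T_def d_def
    by (simp add: power2_eq_square algebra_simps sum_subtractf sum.distrib sum_distrib_left sum_negf)
  \<comment> \<open>The correction to \<open>w j\<close> is thus exactly \<open>d j\<close>, which
    leads to \<open>u j\<close>. In the degenerate case \<open>S = 0\<close> both sides
    vanish.\<close>
  have eq: "2 * d j * T / S = - d j" if "j < p" for j
  proof (cases "S = 0")
    case True
    then have "d j = 0"
      using that by (simp add: S_def sum_nonneg_eq_0_iff)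
    then show ?thesis by simp
  next
    case False
    with S show ?thesis by (simp add: field_simps)
  qed
  have "(\<Sum>i<p. w i * mat_vec p (reflection p d) y i) =
        (\<Sum>i<p. \<Sum>j<p. w i * (((if i = j then 1 else 0) - 2 * d i * d j / S) * y j))"
    by (intro sum.cong) (auto simp: mat_vec_def reflection_def S_def sum_distrib_left)
  also have "\<dots> = (\<Sum>j<p. \<Sum>i<p. w i * (((if i = j then 1 else 0) - 2 * d i * d j / S) * y j))"
    by (rule sum.swap)
  also have "\<dots> = (\<Sum>j<p. (w j - 2 * d j * T / S) * y j)"
  proof (intro sum.cong refl)
    fix j assume j: "j \<in> {..<p}"
    have "(\<Sum>i<p. w i * (((if i = j then 1 else 0) - 2 * d i * d j / S) * y j)) =
       (\<Sum>i<p. (if i = j then w i * y j else 0) - (w i * d i) * (2 * d j / S * y j))"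
      by (intro sum.cong) (auto simp: algebra_simps)
    also have "\<dots> = w j * y j - T * (2 * d j / S * y j)"
      using j by (simp add: sum_subtractf T_def sum_distrib_right sum_divide_distrib)
    also have "\<dots> = (w j - 2 * d j * T / S) * y j"
      by (simp add: algebra_simps)
    finally show "(\<Sum>i<p. w i * (((if i = j then 1 else 0) - 2 * d i * d j / S) * y j)) =
      (w j - 2 * d j * T / S) * y j" .
  qed
  also have "\<dots> = (\<Sum>i<p. u i * y i)"
    using eq by (intro sum.cong) (auto simp: d_def)
  finally show "(\<Sum>i<p. w i * mat_vec p (reflection p (\<lambda>i. u i - w i)) y i) = (\<Sum>i<p. u i * y i)"
    by (simp add: d_def)
qed (rule reflection_orthogonal)

lemma inner_mat_vec:
  assumes "Q \<in> orthogonal_group p"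
  shows "(\<Sum>i<p. mat_vec p Q x i * mat_vec p Q y i) = (\<Sum>i<p. x i * y i)"
proof -
  have "(\<Sum>i<p. mat_vec p Q x i * mat_vec p Q y i) =
      (\<Sum>i<p. \<Sum>j<p. \<Sum>k<p. Q (i, j) * Q (i, k) * (x j * y k))"
    by (intro sum.cong) (auto simp: mat_vec_def sum_product algebra_simps intro!: sum.cong)
  also have "\<dots> = (\<Sum>j<p. \<Sum>k<p. \<Sum>i<p. Q (i, j) * Q (i, k) * (x j * y k))"
    by (rule trans[OF sum.swap], rule sum.cong[OF refl], rule sum.swap)
  also have "\<dots> = (\<Sum>j<p. \<Sum>k<p. if j = k then x j * y k else 0)"
    using assms
    by (intro sum.cong refl) (auto simp: sum_distrib_right[symmetric] orthogonal_group_iff)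
  also have "\<dots> = (\<Sum>j<p. x j * y j)"
    by simp
  finally show ?thesis .
qed

lemma l2_norm_mat_vec:
  assumes "Q \<in> orthogonal_group p"
  shows "l2_norm p (mat_vec p Q y) = l2_norm p y"
  using inner_mat_vec[OF assms, of y y]
  by (simp add: l2_norm_def L2_set_def power2_eq_square)

text \<open>Column \<open>i\<close> of the product is \<open>A\<close> applied to column
  \<open>i\<close> of \<open>B\<close>, and \<open>A\<close> preserves inner products.\<close>

lemma mat_mul_orthogonal:
  assumes "A \<in> orthogonal_group p" "B \<in> orthogonal_group p"
  shows "mat_mul p A B \<in> orthogonal_group p"
proof -
  have "(\<Sum>k<p. mat_mul p A B (k, i) * mat_mul p A B (k, j)) = (\<Sum>k<p. B (k, i) * B (k, j))"
    if "i < p" "j < p" for i j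
  proof -
    have "(\<Sum>k<p. mat_mul p A B (k, i) * mat_mul p A B (k, j)) =
        (\<Sum>k<p. mat_vec p A (\<lambda>l. B (l, i)) k * mat_vec p A (\<lambda>l. B (l, j)) k)"
      using that by (intro sum.cong) (auto simp: mat_mul_def mat_vec_def)
    then show ?thesis
      using inner_mat_vec[OF assms(1)] by simp
  qed
  moreover have "mat_mul p A B \<in> space (rmat p)"
    by (auto simp: rmat_def mat_mul_def space_PiM)
  ultimately show ?thesis
    using assms(2) by (simp add: orthogonal_group_iff)
qed

lemma mat_vec_mat_mul: "mat_vec p (mat_mul p A B) x = mat_vec p A (mat_vec p B x)"
proof
  fix i
  show "mat_vec p (mat_mul p A B) x i = mat_vec p A (mat_vec p B x) i"
  proof (cases "i < p")
    case True
    then have "mat_vec p (mat_mul p A B) x i = (\<Sum>j<p. \<Sum>k<p. A (i, k) * B (k, j) * x j)"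
      by (simp add: mat_vec_def mat_mul_def sum_distrib_right)
    also have "\<dots> = (\<Sum>k<p. \<Sum>j<p. A (i, k) * B (k, j) * x j)"
      by (rule sum.swap)
    also have "\<dots> = mat_vec p A (mat_vec p B x) i"
      using True by (simp add: mat_vec_def sum_distrib_left mult.assoc)
    finally show ?thesis .
  qed (simp add: mat_vec_def)
qed

section \<open>Inequalities for the Euclidean and the sup norm\<close>

lemma l2_norm_vec_add: "l2_norm p (vec_add p x y) \<le> l2_norm p x + l2_norm p y"
proof -
  have "l2_norm p (vec_add p x y) = L2_set (\<lambda>i. x i + y i) {..<p}"
    unfolding l2_norm_def by (intro L2_set_cong) (auto simp: vec_add_def)
  then show ?thesis
    by (simp add: l2_norm_def L2_set_triangle_ineq)
qed

text \<open>The assumption \<open>p \<ge> 1\<close> keeps \<open>Max\<close> away from the empty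
  set, where its value is unspecified.\<close>

lemma linf_norm_le_iff: "p \<ge> 1 \<Longrightarrow> linf_norm p x \<le> a \<longleftrightarrow> (\<forall>i<p. \<bar>x i\<bar> \<le> a)"
  by (subst linf_norm_def, subst Max_le_iff) (auto simp: lessThan_empty_iff)

lemma abs_le_linf_norm: "i < p \<Longrightarrow> \<bar>x i\<bar> \<le> linf_norm p x"
  by (auto simp: linf_norm_def intro!: Max_ge)

text \<open>The triangle inequality is put in this form to bound the sup norm of an observation from
  below by that of the signal \<open>x\<close>, up to the noise \<open>y\<close>.\<close>

lemma linf_norm_vec_add:
  assumes "p \<ge> 1"
  shows "linf_norm p x \<le> linf_norm p (vec_add p x y) + linf_norm p y"
  unfolding linf_norm_le_iff[OF assms]
proof (intro allI impI)
  fix i assume "i < p"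
  then show "\<bar>x i\<bar> \<le> linf_norm p (vec_add p x y) + linf_norm p y"
    using abs_le_linf_norm[of i p "vec_add p x y"] abs_le_linf_norm[of i p y]
    by (auto simp: vec_add_def)
qed

lemma linf_norm_nonneg: "p \<ge> 1 \<Longrightarrow> linf_norm p x \<ge> 0"
  using abs_le_linf_norm[of 0 p x] by simp

subsection \<open>Spherical vectors\<close>

lemma space_orth_space: "space (orth_space p) = orthogonal_group p"
  by (auto simp: orth_space_def orthogonal_group_def space_restrict_space)

lemma measurable_rvec_component [measurable (raw)]:
  "f \<in> M \<rightarrow>\<^sub>M rvec p \<Longrightarrow> i < p \<Longrightarrow> (\<lambda>\<omega>. f \<omega> i) \<in> borel_measurable M"
  unfolding rvec_def by (rule measurable_component_singleton[THEN measurable_compose_rev]) auto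

lemma measurable_orth_space_component [measurable (raw)]:
  assumes "f \<in> M \<rightarrow>\<^sub>M orth_space p" "i < p" "j < p"
  shows "(\<lambda>\<omega>. f \<omega> (i, j)) \<in> borel_measurable M"
proof -
  have "(\<lambda>A. A (i, j)) \<in> borel_measurable (orth_space p)"
    unfolding orth_space_def rmat_def using assms(2,3)
    by (intro measurable_restrict_space1 measurable_component_singleton) auto
  with assms(1) show ?thesis
    by (rule measurable_compose)
qed

lemma measurable_l2_norm [measurable]: "l2_norm p \<in> borel_measurable (rvec p)"
  unfolding l2_norm_def[abs_def] L2_set_def
  by (intro measurable_compose[OF _ borel_measurable_sqrt] borel_measurable_sum borel_measurable_power
      measurable_rvec_component[OF measurable_ident_sets[OF refl]]) auto

lemma measurable_linf_norm [measurable]: "linf_norm p \<in> borel_measurable (rvec p)"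
  unfolding linf_norm_def[abs_def]
  by (intro borel_measurable_Max borel_measurable_abs
      measurable_rvec_component[OF measurable_ident_sets[OF refl]]) auto

lemma measurable_vec_add [measurable (raw)]:
  assumes "f \<in> M \<rightarrow>\<^sub>M rvec p"
  shows "(\<lambda>\<omega>. vec_add p s (f \<omega>)) \<in> M \<rightarrow>\<^sub>M rvec p"
  unfolding vec_add_def rvec_def using assms
  by (intro measurable_restrict borel_measurable_add)
    (auto intro: measurable_rvec_component)

lemma measurable_mat_vec [measurable (raw)]:
  assumes "f \<in> M \<rightarrow>\<^sub>M orth_space p" "g \<in> M \<rightarrow>\<^sub>M rvec p"
  shows "(\<lambda>\<omega>. mat_vec p (f \<omega>) (g \<omega>)) \<in> M \<rightarrow>\<^sub>M rvec p"
  unfolding mat_vec_def rvec_def using assms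
  by (intro measurable_restrict borel_measurable_sum borel_measurable_times
      measurable_rvec_component measurable_orth_space_component) auto

lemma measurable_mat_mul:
  assumes "Q \<in> orthogonal_group p"
  shows "mat_mul p Q \<in> orth_space p \<rightarrow>\<^sub>M orth_space p"
proof -
  have "mat_mul p Q \<in> orth_space p \<rightarrow>\<^sub>M rmat p"
    unfolding mat_mul_def[abs_def] rmat_def
    by (intro measurable_restrict)
      (auto intro!: borel_measurable_sum borel_measurable_times
        measurable_orth_space_component[OF measurable_ident_sets[OF refl]])
  then show ?thesis
    unfolding orth_space_def
    by (rule measurable_restrict_space2[rotated])
      (use assms mat_mul_orthogonal in \<open>auto simp: space_orth_space[unfolded orth_space_def]\<close>)
qed

text \<open>Applying \<open>Q\<close> to \<open>mat_vec p A x\<close> amounts to translating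
  \<open>A\<close> by \<open>Q\<close> from the left, under which Haar measure is invariant. Through
  this lemma the tail bound for spherical vectors applies to a fixed observation rotated by a random
  draw.\<close>

lemma spherical_haar:
  assumes "haar_prob p \<mu>" "x \<in> space (rvec p)"
  shows "spherical p \<mu> (\<lambda>A. mat_vec p A x)"
  unfolding spherical_def
proof safe
  have sets: "sets \<mu> = sets (orth_space p)"
    using assms(1) by (simp add: haar_prob_def)
  have meas: "(\<lambda>A. mat_vec p A x) \<in> orth_space p \<rightarrow>\<^sub>M rvec p"
    using assms(2) by (intro measurable_mat_vec measurable_const measurable_ident_sets[OF refl])
  then show "(\<lambda>A. mat_vec p A x) \<in> \<mu> \<rightarrow>\<^sub>M rvec p"
    by (simp add: sets cong: measurable_cong_sets)
  fix Q assume Q: "Q \<in> orthogonal_group p"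
  have "distr \<mu> (rvec p) (\<lambda>A. mat_vec p A x) =
      distr (distr \<mu> (orth_space p) (mat_mul p Q)) (rvec p) (\<lambda>A. mat_vec p A x)"
    using assms(1) Q by (simp add: haar_prob_def)
  also have "\<dots> = distr \<mu> (rvec p) (\<lambda>A. mat_vec p Q (mat_vec p A x))"
    using measurable_mat_mul[OF Q] meas
    by (subst distr_distr) (auto simp: comp_def mat_vec_mat_mul sets cong: measurable_cong_sets)
  finally show "distr \<mu> (rvec p) (\<lambda>A. mat_vec p Q (mat_vec p A x)) =
    distr \<mu> (rvec p) (\<lambda>A. mat_vec p A x)" ..
qed

section \<open>Tail bound for the sup norm of a spherical vector\<close>

lemma abs_le_l2_norm: "i < p \<Longrightarrow> \<bar>x i\<bar> \<le> l2_norm p x"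
  unfolding l2_norm_def using member_le_L2_set[of "{..<p}" i "\<lambda>i. \<bar>x i\<bar>"]
  by (simp add: L2_set_def)

lemma l2_norm_nonneg: "l2_norm p x \<ge> 0"
  by (simp add: l2_norm_def)

text \<open>The sum over all sign vectors factorizes over the coordinates, each of which contributes
  \<open>2 * cosh (x i)\<close>.\<close>

lemma sum_sign_vectors_exp_le:
  fixes x :: "nat \<Rightarrow> real"
  shows "(\<Sum>z\<in>PiE {..<p} (\<lambda>_. {-1, 1}). exp (\<Sum>i<p. z i * x i)) \<le> 2 ^ p * exp ((l2_norm p x)\<^sup>2 / 2)"
proof -
  have "(\<Sum>z\<in>PiE {..<p} (\<lambda>_. {-1, 1}). exp (\<Sum>i<p. z i * x i)) =
      (\<Sum>z\<in>PiE {..<p} (\<lambda>_. {-1, 1}). \<Prod>i<p. exp (z i * x i))"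
    by (simp add: exp_sum)
  also have "\<dots> = (\<Prod>i<p. \<Sum>a\<in>{-1, 1}. exp (a * x i))"
    by (subst prod_sum_PiE) auto
  also have "\<dots> = (\<Prod>i<p. 2 * cosh (x i))"
  proof (intro prod.cong refl)
    fix i
    have "2 * cosh (x i) = exp (x i) + exp (- x i)"
      unfolding cosh_field_def by simp
    then show "(\<Sum>a\<in>{-1, 1}. exp (a * x i)) = 2 * cosh (x i)"
      by simp
  qed
  also have "\<dots> \<le> (\<Prod>i<p. 2 * exp ((x i)\<^sup>2 / 2))"
    by (intro prod_mono) (auto simp: cosh_le_exp_half_square)
  also have "\<dots> = 2 ^ p * exp ((l2_norm p x)\<^sup>2 / 2)"
    by (simp add: prod.distrib l2_norm_def L2_set_def sum_nonneg sum_divide_distrib flip: exp_sum)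
  finally show ?thesis .
qed

context
  fixes M :: "'a measure" and p :: nat and Y :: "'a \<Rightarrow> nat \<Rightarrow> real"
  assumes prob: "prob_space M" and spherical: "spherical p M Y"
begin

interpretation prob_space M by (rule prob)

lemma measurable_spherical: "Y \<in> M \<rightarrow>\<^sub>M rvec p"
  using spherical by (simp add: spherical_def)

lemma measurable_spherical_direction:
  "(\<lambda>\<omega>. (\<Sum>i<p. v i * Y \<omega> i) / l2_norm p (Y \<omega>)) \<in> borel_measurable M"
proof (intro borel_measurable_divide borel_measurable_sum borel_measurable_times
    borel_measurable_const)
  show "(\<lambda>\<omega>. Y \<omega> i) \<in> borel_measurable M" if "i \<in> {..<p}" for i
    using that by (intro measurable_rvec_component[OF measurable_spherical]) auto
  show "(\<lambda>\<omega>. l2_norm p (Y \<omega>)) \<in> borel_measurable M"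
    using measurable_spherical measurable_l2_norm by (rule measurable_compose)
qed

text \<open>Normalizing by the Euclidean norm bounds the exponent, so the exponential is integrable
  whatever the tails of \<open>Y\<close>.\<close>

lemma integrable_exp_spherical_direction:
  "integrable M (\<lambda>\<omega>. exp (l * ((\<Sum>i<p. v i * Y \<omega> i) / l2_norm p (Y \<omega>))))"
proof (rule integrable_const_bound)
  show "AE \<omega> in M. norm (exp (l * ((\<Sum>i<p. v i * Y \<omega> i) / l2_norm p (Y \<omega>)))) \<le>
      exp (\<bar>l\<bar> * (\<Sum>i<p. \<bar>v i\<bar>))"
  proof (intro AE_I2)
    fix \<omega>
    have "\<bar>(\<Sum>i<p. v i * Y \<omega> i) / l2_norm p (Y \<omega>)\<bar> \<le> (\<Sum>i<p. \<bar>v i\<bar>)"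
    proof (cases "l2_norm p (Y \<omega>) = 0")
      case True
      then show ?thesis by (simp add: sum_nonneg)
    next
      case False
      then have pos: "l2_norm p (Y \<omega>) > 0"
        using l2_norm_nonneg[of p "Y \<omega>"] by simp
      have "\<bar>\<Sum>i<p. v i * Y \<omega> i\<bar> \<le> (\<Sum>i<p. \<bar>v i * Y \<omega> i\<bar>)"
        by (rule sum_abs)
      also have "\<dots> \<le> (\<Sum>i<p. \<bar>v i\<bar> * l2_norm p (Y \<omega>))"
        by (intro sum_mono) (auto simp: abs_mult intro!: mult_left_mono abs_le_l2_norm)
      finally show ?thesis
        using pos by (simp add: abs_divide divide_le_eq sum_distrib_right)
    qed
    then have "\<bar>l * ((\<Sum>i<p. v i * Y \<omega> i) / l2_norm p (Y \<omega>))\<bar> \<le> \<bar>l\<bar> * (\<Sum>i<p. \<bar>v i\<bar>)"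
      unfolding abs_mult by (intro mult_left_mono) auto
    from abs_le_D1[OF this] show "norm (exp (l * ((\<Sum>i<p. v i * Y \<omega> i) / l2_norm p (Y \<omega>)))) \<le>
      exp (\<bar>l\<bar> * (\<Sum>i<p. \<bar>v i\<bar>))"
      by simp
  qed
  show "(\<lambda>\<omega>. exp (l * ((\<Sum>i<p. v i * Y \<omega> i) / l2_norm p (Y \<omega>)))) \<in> borel_measurable M"
    by (intro measurable_compose[OF _ borel_measurable_exp] borel_measurable_times
        borel_measurable_const measurable_spherical_direction)
qed

text \<open>An orthogonal matrix \<open>Q\<close> carries one linear form into the other without
  changing the Euclidean norm, and \<open>Y\<close> has the same law as its image under
  \<open>Q\<close>.\<close>

lemma expectation_exp_spherical_direction_cong:
  assumes "(\<Sum>i<p. (v i)\<^sup>2) = (\<Sum>i<p. (w i)\<^sup>2)"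
  shows "expectation (\<lambda>\<omega>. exp (l * ((\<Sum>i<p. v i * Y \<omega> i) / l2_norm p (Y \<omega>)))) =
    expectation (\<lambda>\<omega>. exp (l * ((\<Sum>i<p. w i * Y \<omega> i) / l2_norm p (Y \<omega>))))"
proof -
  obtain Q where Q: "Q \<in> orthogonal_group p"
    and eq: "\<And>y. (\<Sum>i<p. w i * mat_vec p Q y i) = (\<Sum>i<p. v i * y i)"
    using ex_orthogonal_inner[OF assms] by blast
  define F where "F = (\<lambda>y. exp (l * ((\<Sum>i<p. w i * y i) / l2_norm p y)))"
  have F: "F \<in> borel_measurable (rvec p)"
    unfolding F_def
    by (intro measurable_compose[OF _ borel_measurable_exp] borel_measurable_times
        borel_measurable_divide borel_measurable_sum measurable_l2_norm
        measurable_rvec_component[OF measurable_ident_sets[OF refl]]) auto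
  have "(\<lambda>_. Q) \<in> M \<rightarrow>\<^sub>M orth_space p"
    using Q by (simp add: space_orth_space)
  then have QY: "(\<lambda>\<omega>. mat_vec p Q (Y \<omega>)) \<in> M \<rightarrow>\<^sub>M rvec p"
    using measurable_spherical by (rule measurable_mat_vec)
  have "expectation (\<lambda>\<omega>. F (Y \<omega>)) = integral\<^sup>L (distr M (rvec p) Y) F"
    using measurable_spherical F by (rule integral_distr[symmetric])
  also have "distr M (rvec p) Y = distr M (rvec p) (\<lambda>\<omega>. mat_vec p Q (Y \<omega>))"
    using spherical Q by (simp add: spherical_def)
  also have "integral\<^sup>L \<dots> F = expectation (\<lambda>\<omega>. F (mat_vec p Q (Y \<omega>)))"
    using QY F by (rule integral_distr)
  finally show ?thesis
    by (simp add: F_def eq l2_norm_mat_vec[OF Q])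
qed

lemma expectation_exp_spherical_direction_le:
  assumes v: "(\<Sum>i<p. (v i)\<^sup>2) = real p"
  shows "expectation (\<lambda>\<omega>. exp (l * ((\<Sum>i<p. v i * Y \<omega> i) / l2_norm p (Y \<omega>)))) \<le> exp (l\<^sup>2 / 2)"
proof -
  define E where
    "E = (\<lambda>v. expectation (\<lambda>\<omega>. exp (l * ((\<Sum>i<p. v i * Y \<omega> i) / l2_norm p (Y \<omega>)))))"
  \<comment> \<open>Sign vectors have squared length \<open>p\<close>, the same as \<open>v\<close>,
    so the expectation for \<open>v\<close> equals that for each of them.\<close>
  define Z where "Z = PiE {..<p} (\<lambda>_. {-1, 1 :: real})"
  have card_Z: "card Z = 2 ^ p"
    by (simp add: Z_def card_PiE numeral_2_eq_2)
  have E_eq: "E z = E v" if "z \<in> Z" for z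
    unfolding E_def
  proof (rule expectation_exp_spherical_direction_cong)
    have "z i = - 1 \<or> z i = 1" if "i < p" for i
      using \<open>z \<in> Z\<close> that by (auto simp: Z_def PiE_def Pi_def)
    then have "(\<Sum>i<p. (z i)\<^sup>2) = (\<Sum>i<p. 1)"
      by (intro sum.cong) (auto simp: power2_eq_1_iff)
    then show "(\<Sum>i<p. (z i)\<^sup>2) = (\<Sum>i<p. (v i)\<^sup>2)"
      using v by simp
  qed
  have "2 ^ p * E v = (\<Sum>z\<in>Z. E z)"
    by (simp add: E_eq card_Z)
  also have "\<dots> = expectation
      (\<lambda>\<omega>. \<Sum>z\<in>Z. exp (l * ((\<Sum>i<p. z i * Y \<omega> i) / l2_norm p (Y \<omega>))))"
    unfolding E_def
    by (rule Bochner_Integration.integral_sum[symmetric])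
      (rule integrable_exp_spherical_direction)
  also have "\<dots> \<le> expectation (\<lambda>_. 2 ^ p * exp (l\<^sup>2 / 2))"
  proof (intro integral_mono Bochner_Integration.integrable_sum integrable_exp_spherical_direction
      integrable_const)
    fix \<omega>
    define x where "x = (\<lambda>i. l * Y \<omega> i / l2_norm p (Y \<omega>))"
    have "(l2_norm p x)\<^sup>2 = l\<^sup>2 * (l2_norm p (Y \<omega>))\<^sup>2 / (l2_norm p (Y \<omega>))\<^sup>2"
      by (simp add: l2_norm_def L2_set_def sum_nonneg x_def power_mult_distrib power_divide
          sum_distrib_left sum_divide_distrib)
    \<comment> \<open>Equality holds unless \<open>Y \<omega>\<close> has norm 0; there the quotient
      is \<open>0 / 0 = 0\<close>.\<close>
    also have "\<dots> \<le> l\<^sup>2"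
      by (cases "l2_norm p (Y \<omega>) = 0") auto
    finally have x: "(l2_norm p x)\<^sup>2 \<le> l\<^sup>2" .
    have "l * ((\<Sum>i<p. z i * Y \<omega> i) / l2_norm p (Y \<omega>)) = (\<Sum>i<p. z i * x i)" for z
      by (simp add: x_def sum_distrib_left sum_divide_distrib algebra_simps)
    then have "(\<Sum>z\<in>Z. exp (l * ((\<Sum>i<p. z i * Y \<omega> i) / l2_norm p (Y \<omega>)))) \<le>
        2 ^ p * exp ((l2_norm p x)\<^sup>2 / 2)"
      using sum_sign_vectors_exp_le[of x p] by (simp add: Z_def)
    also have "\<dots> \<le> 2 ^ p * exp (l\<^sup>2 / 2)"
      using x by simp
    finally show "(\<Sum>z\<in>Z. exp (l * ((\<Sum>i<p. z i * Y \<omega> i) / l2_norm p (Y \<omega>)))) \<le>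
        2 ^ p * exp (l\<^sup>2 / 2)" .
  qed
  also have "\<dots> = 2 ^ p * exp (l\<^sup>2 / 2)"
    by (simp add: prob_space)
  finally show ?thesis
    by (simp add: E_def)
qed

text \<open>Chernoff's bound with the exponential parameter equal to the threshold \<open>l\<close>,
  the choice that minimizes the resulting exponent.\<close>

lemma prob_spherical_direction_ge:
  assumes "(\<Sum>i<p. (v i)\<^sup>2) = real p" "l > 0"
  shows "prob {\<omega> \<in> space M. (\<Sum>i<p. v i * Y \<omega> i) / l2_norm p (Y \<omega>) \<ge> l} \<le> exp (- (l\<^sup>2 / 2))"
proof -
  define X where "X = (\<lambda>\<omega>. (\<Sum>i<p. v i * Y \<omega> i) / l2_norm p (Y \<omega>))"
  have int: "integrable M (\<lambda>\<omega>. exp (l * X \<omega>))"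
    unfolding X_def by (rule integrable_exp_spherical_direction)
  then have "set_integrable M (space M) (\<lambda>\<omega>. exp (l * X \<omega>))"
    unfolding set_integrable_def by (rule integrable_mult_indicator[OF sets.top])
  then have "prob {\<omega> \<in> space M. X \<omega> \<ge> l} \<le> exp (- l * l) * (\<integral>\<omega>\<in>space M. exp (l * X \<omega>) \<partial>M)"
    using assms(2) by (intro Chernoff_ineq_ge) auto
  also have "(\<integral>\<omega>\<in>space M. exp (l * X \<omega>) \<partial>M) = expectation (\<lambda>\<omega>. exp (l * X \<omega>))"
    using int by (rule set_integral_space)
  also have "\<dots> \<le> exp (l\<^sup>2 / 2)"
    unfolding X_def using assms(1) by (rule expectation_exp_spherical_direction_le)
  also have "exp (- l * l) * exp (l\<^sup>2 / 2) = exp (- (l\<^sup>2 / 2))"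
    by (simp add: power2_eq_square flip: exp_add)
  finally show ?thesis
    by (simp add: X_def)
qed

text \<open>A union bound over the \<open>2 * p\<close> signed coordinate directions. It serves both
  for the noise and, under Haar measure, for a rotated fixed vector.\<close>

lemma prob_spherical_linf_norm_gt:
  assumes "p \<ge> 1" "a > 0"
  shows "prob {\<omega> \<in> space M. linf_norm p (Y \<omega>) > a * l2_norm p (Y \<omega>)} \<le>
    2 * real p * exp (- (real p * a\<^sup>2 / 2))"
proof -
  \<comment> \<open>Scaling the coordinate vectors by \<open>sqrt (real p)\<close> gives the squared
    length \<open>p\<close> required above and turns the threshold \<open>a\<close> into
    \<open>l\<close>.\<close>
  define v where "v = (\<lambda>(i :: nat, \<sigma>) (j :: nat). if j = i then \<sigma> * sqrt (real p) else 0 :: real)"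
  define l where "l = sqrt (real p) * a"
  define I where "I = {..<p} \<times> {-1, 1 :: real}"
  define B where
    "B = (\<lambda>c. {\<omega> \<in> space M. (\<Sum>i<p. v c i * Y \<omega> i) / l2_norm p (Y \<omega>) \<ge> l})"
  have B: "B c \<in> events" for c
    unfolding B_def using measurable_spherical_direction by (rule borel_measurable_le[OF borel_measurable_const])
  have l: "l > 0" "l\<^sup>2 = real p * a\<^sup>2"
    using assms by (auto simp: l_def power_mult_distrib)
  have "{\<omega> \<in> space M. linf_norm p (Y \<omega>) > a * l2_norm p (Y \<omega>)} \<subseteq> (\<Union>c\<in>I. B c)"
  proof safe
    fix \<omega> assume \<omega>: "\<omega> \<in> space M" "linf_norm p (Y \<omega>) > a * l2_norm p (Y \<omega>)"
    then obtain i where i: "i < p" "\<bar>Y \<omega> i\<bar> > a * l2_norm p (Y \<omega>)"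
      using linf_norm_le_iff[OF assms(1)] by (meson not_le)
    \<comment> \<open>If the norm were 0, the coordinate \<open>Y \<omega> i\<close> would be 0 as
      well, against the strict inequality in \<open>i\<close>.\<close>
    have pos: "l2_norm p (Y \<omega>) > 0"
      using i abs_le_l2_norm[of i p "Y \<omega>"] l2_norm_nonneg[of p "Y \<omega>"] assms(2)
      by (cases "l2_norm p (Y \<omega>) = 0") auto
    define \<sigma> :: real where "\<sigma> = (if Y \<omega> i \<ge> 0 then 1 else -1)"
    have "(\<Sum>j<p. v (i, \<sigma>) j * Y \<omega> j) = (\<Sum>j<p. if j = i then \<sigma> * sqrt (real p) * Y \<omega> j else 0)"
      by (intro sum.cong) (auto simp: v_def)
    also have "\<dots> = sqrt (real p) * \<bar>Y \<omega> i\<bar>"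
      using i by (simp add: \<sigma>_def)
    also have "\<dots> \<ge> sqrt (real p) * (a * l2_norm p (Y \<omega>))"
      using i by (intro mult_left_mono) auto
    finally have "\<omega> \<in> B (i, \<sigma>)"
      using \<omega>(1) pos by (simp add: B_def l_def le_divide_eq mult.assoc)
    moreover have "(i, \<sigma>) \<in> I"
      using i by (simp add: I_def \<sigma>_def)
    ultimately show "\<omega> \<in> (\<Union>c\<in>I. B c)"
      by blast
  qed
  then have "prob {\<omega> \<in> space M. linf_norm p (Y \<omega>) > a * l2_norm p (Y \<omega>)} \<le> prob (\<Union>c\<in>I. B c)"
    using B by (intro finite_measure_mono sets.finite_UN) (auto simp: I_def)
  also have "\<dots> \<le> (\<Sum>c\<in>I. prob (B c))"
    using B by (intro measure_UNION_le) (auto simp: I_def)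
  also have "\<dots> \<le> (\<Sum>c\<in>I. exp (- (l\<^sup>2 / 2)))"
    unfolding B_def
  proof (intro sum_mono prob_spherical_direction_ge l(1))
    fix c assume "c \<in> I"
    then obtain i \<sigma> where c: "c = (i, \<sigma>)" "i < p" "\<sigma> = - 1 \<or> \<sigma> = 1"
      by (auto simp: I_def)
    then have "(\<Sum>j<p. (v c j)\<^sup>2) = (\<Sum>j<p. if j = i then real p else 0)"
      by (intro sum.cong) (auto simp: v_def)
    then show "(\<Sum>j<p. (v c j)\<^sup>2) = real p"
      using c by simp
  qed
  also have "\<dots> = 2 * real p * exp (- (real p * a\<^sup>2 / 2))"
    by (simp add: I_def l card_cartesian_product)
  finally show ?thesis .
qed

end

subsection \<open>Randomization tests\<close>

text \<open>Sorting moves the entries below \<open>v\<close> to the front, so a comparison with an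
  order statistic becomes a count. The shift by 1 reconciles ranks starting at 1 with list positions
  starting at 0.\<close>

lemma sort_nth_less_iff:
  fixes v :: "'a :: linorder"
  assumes "k \<ge> 1" "k \<le> length xs"
  shows "sort xs ! (k - 1) < v \<longleftrightarrow> k \<le> length (filter (\<lambda>x. x < v) xs)"
proof -
  define ys where "ys = sort xs"
  have ys: "sorted ys" "length ys = length xs"
    by (auto simp: ys_def)
  have "length (filter (\<lambda>x. x < v) xs) = length (filter (\<lambda>x. x < v) ys)"
    by (simp add: ys_def filter_sort)
  also have "\<dots> = card {i. i < length ys \<and> ys ! i < v}"
    by (rule length_filter_conv_card)
  finally have len: "length (filter (\<lambda>x. x < v) xs) = card {i. i < length ys \<and> ys ! i < v}" .
  have "ys ! (k - 1) < v \<longleftrightarrow> k \<le> card {i. i < length ys \<and> ys ! i < v}"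
  proof
    assume less: "ys ! (k - 1) < v"
    have "ys ! i < v" if "i < k" for i
      using sorted_nth_mono[OF ys(1), of i "k - 1"] that assms less ys(2) by fastforce
    then have "{..<k} \<subseteq> {i. i < length ys \<and> ys ! i < v}"
      using assms ys(2) by auto
    from card_mono[OF _ this] show "k \<le> card {i. i < length ys \<and> ys ! i < v}"
      by simp
  next
    assume le: "k \<le> card {i. i < length ys \<and> ys ! i < v}"
    show "ys ! (k - 1) < v"
    proof (rule ccontr)
      assume nless: "\<not> ys ! (k - 1) < v"
      have "i < k - 1" if "i < length ys" "ys ! i < v" for i
        using sorted_nth_mono[OF ys(1), of "k - 1" i] that nless by fastforce
      then have "{i. i < length ys \<and> ys ! i < v} \<subseteq> {..<k - 1}"
        by auto
      from card_mono[OF _ this] show False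
        using le assms(1) by simp
    qed
  qed
  then show ?thesis
    by (simp add: len ys_def)
qed

text \<open>The observed value is in the list but never below itself, so only rotated values are
  counted. Nonnegativity of \<open>\<alpha>\<close> keeps the rank within the list; rank 0 means
  certain rejection on both sides.\<close>

lemma randomization_rejects_iff:
  assumes "0 \<le> \<alpha>"
  shows "randomization_rejects \<alpha> K f act g x \<longleftrightarrow>
    nat \<lceil>(1 - \<alpha>) * (real K + 1)\<rceil> \<le> card {j \<in> {1..K}. f (act (g j) x) < f x}"
proof -
  define k where "k = nat \<lceil>(1 - \<alpha>) * (real K + 1)\<rceil>"
  define xs where "xs = f x # map (\<lambda>j. f (act (g j) x)) [1..<Suc K]"
  have "(1 - \<alpha>) * (real K + 1) \<le> 1 * (real K + 1)"
    using assms by (intro mult_right_mono) auto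
  also have "\<dots> = real (Suc K)"
    by simp
  finally have "(1 - \<alpha>) * (real K + 1) \<le> real (Suc K)" .
  moreover have "length xs = Suc K"
    by (simp add: xs_def del: upt_Suc)
  ultimately have k: "k \<le> length xs"
    by (simp add: k_def nat_le_iff ceiling_le_iff)
  have "length (filter (\<lambda>y. y < f x) xs) =
      length (filter (\<lambda>j. f (act (g j) x) < f x) [1..<Suc K])"
    by (simp add: xs_def filter_map comp_def del: upt_Suc)
  also have "\<dots> = card {j \<in> {1..K}. f (act (g j) x) < f x}"
    by (subst distinct_card[symmetric]) (auto intro!: arg_cong[where f = card] simp del: upt_Suc)
  finally have len: "length (filter (\<lambda>y. y < f x) xs) = card {j \<in> {1..K}. f (act (g j) x) < f x}" .
  have "randomization_rejects \<alpha> K f act g x \<longleftrightarrow> order_stat xs k < ereal (f x)"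
    by (simp only: randomization_rejects_def k_def xs_def)
  also have "\<dots> \<longleftrightarrow> k \<le> length (filter (\<lambda>y. y < f x) xs)"
    using sort_nth_less_iff[of k xs "f x"] k by (cases "k = 0") (auto simp: order_stat_def)
  finally show ?thesis
    unfolding len k_def .
qed

text \<open>The first assumption says that the critical rank is at most \<open>K\<close>. If it
  fails for some \<open>\<alpha> \<ge> 0\<close>, the rank is \<open>K + 1\<close> and the observed
  value would have to exceed a maximum that includes it.\<close>

lemma randomization_rejects_if_greatest:
  assumes "\<alpha> * (real K + 1) \<ge> 1" "\<And>j. j \<in> {1..K} \<Longrightarrow> f (act (g j) x) < f x"
  shows "randomization_rejects \<alpha> K f act g x"
proof -
  have "(1 - \<alpha>) * (real K + 1) \<le> real K"
    using assms(1) by (simp add: algebra_simps)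
  then have "nat \<lceil>(1 - \<alpha>) * (real K + 1)\<rceil> \<le> K"
    by (simp add: nat_le_iff ceiling_le_iff)
  moreover have "{j \<in> {1..K}. f (act (g j) x) < f x} = {1..K}"
    using assms(2) by auto
  moreover have "0 \<le> \<alpha>"
  proof (rule ccontr)
    assume "\<not> 0 \<le> \<alpha>"
    then have "\<alpha> * (real K + 1) \<le> 0"
      by (intro mult_nonpos_nonneg) auto
    with assms(1) show False by simp
  qed
  ultimately show ?thesis
    by (simp add: randomization_rejects_iff)
qed

text \<open>The count of smaller rotated values is a sum of indicators of measurable events.\<close>

lemma measurable_randomization_rejects:
  assumes "0 \<le> \<alpha>"
    and fX: "(\<lambda>\<omega>. f (X \<omega>)) \<in> borel_measurable M"
    and fGX: "\<And>j. j \<in> {1..K} \<Longrightarrow> (\<lambda>\<omega>. f (act (G j \<omega>) (X \<omega>))) \<in> borel_measurable M"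
  shows "{\<omega> \<in> space M. randomization_rejects \<alpha> K f act (\<lambda>j. G j \<omega>) (X \<omega>)} \<in> sets M"
proof -
  define A where "A = (\<lambda>j. {\<omega> \<in> space M. f (act (G j \<omega>) (X \<omega>)) < f (X \<omega>)})"
  define k where "k = nat \<lceil>(1 - \<alpha>) * (real K + 1)\<rceil>"
  have A: "A j \<in> sets M" if "j \<in> {1..K}" for j
    unfolding A_def using fGX[OF that] fX by (rule borel_measurable_less)
  have card: "real (card {j \<in> {1..K}. f (act (G j \<omega>) (X \<omega>)) < f (X \<omega>)}) =
      (\<Sum>j\<in>{1..K}. indicator (A j) \<omega>)" if "\<omega> \<in> space M" for \<omega>
  proof -
    have "(\<Sum>j\<in>{1..K}. indicator (A j) \<omega> :: real) =
        (\<Sum>j\<in>{1..K}. if f (act (G j \<omega>) (X \<omega>)) < f (X \<omega>) then 1 else 0)"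
      using that by (intro sum.cong) (auto simp: A_def)
    then show ?thesis
      by (simp add: sum.If_cases Int_def)
  qed
  have "randomization_rejects \<alpha> K f act (\<lambda>j. G j \<omega>) (X \<omega>) \<longleftrightarrow>
      real k \<le> (\<Sum>j\<in>{1..K}. indicator (A j) \<omega>)" if "\<omega> \<in> space M" for \<omega>
    unfolding randomization_rejects_iff[OF assms(1)] card[OF that, symmetric] k_def
    by (simp only: of_nat_le_iff)
  then have "{\<omega> \<in> space M. randomization_rejects \<alpha> K f act (\<lambda>j. G j \<omega>) (X \<omega>)} =
      {\<omega> \<in> space M. real k \<le> (\<Sum>j\<in>{1..K}. indicator (A j) \<omega>)}"
    by blast
  also have "\<dots> \<in> sets M"
    using A by (intro borel_measurable_le borel_measurable_sum borel_measurable_indicator) auto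
  finally show ?thesis .
qed

section \<open>Joint law of the noise and the draws, and the power bound\<close>

text \<open>The product rule on rectangles determines the joint law. Stating it for preimages lets
  \<open>X\<close> and \<open>Y\<close> have different types.\<close>

lemma (in prob_space) distr_pair_eqI:
  assumes X: "X \<in> M \<rightarrow>\<^sub>M S" and Y: "Y \<in> M \<rightarrow>\<^sub>M T"
    and indep: "\<And>A B. A \<in> sets S \<Longrightarrow> B \<in> sets T \<Longrightarrow>
      prob ((X -` A \<inter> space M) \<inter> (Y -` B \<inter> space M)) =
      prob (X -` A \<inter> space M) * prob (Y -` B \<inter> space M)"
  shows "distr M (S \<Otimes>\<^sub>M T) (\<lambda>\<omega>. (X \<omega>, Y \<omega>)) = distr M S X \<Otimes>\<^sub>M distr M T Y"
proof (rule pair_measure_eqI[symmetric])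
  show "sigma_finite_measure (distr M S X)" "sigma_finite_measure (distr M T Y)"
    using X Y by (auto intro!: prob_space_imp_sigma_finite prob_space_distr)
  show "sets (distr M S X \<Otimes>\<^sub>M distr M T Y) = sets (distr M (S \<Otimes>\<^sub>M T) (\<lambda>\<omega>. (X \<omega>, Y \<omega>)))"
    by (simp cong: sets_pair_measure_cong)
  fix A B assume "A \<in> sets (distr M S X)" "B \<in> sets (distr M T Y)"
  then have A: "A \<in> sets S" and B: "B \<in> sets T"
    by auto
  have XY: "(\<lambda>\<omega>. (X \<omega>, Y \<omega>)) \<in> M \<rightarrow>\<^sub>M S \<Otimes>\<^sub>M T"
    using X Y by (rule measurable_Pair)
  have "(\<lambda>\<omega>. (X \<omega>, Y \<omega>)) -` (A \<times> B) \<inter> space M =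
      (X -` A \<inter> space M) \<inter> (Y -` B \<inter> space M)"
    by auto
  then show "emeasure (distr M S X) A * emeasure (distr M T Y) B =
      emeasure (distr M (S \<Otimes>\<^sub>M T) (\<lambda>\<omega>. (X \<omega>, Y \<omega>))) (A \<times> B)"
    using A B X Y XY indep[OF A B]
    by (simp add: emeasure_distr emeasure_eq_measure ennreal_mult)
qed

lemma distr_noise_draw:
  assumes prob: "prob_space M"
    and noise: "N \<in> M \<rightarrow>\<^sub>M rvec p"
    and draws: "iid_draws p K \<mu> M N G"
    and j: "j \<in> {1..K}"
  shows "distr M (rvec p \<Otimes>\<^sub>M orth_space p) (\<lambda>\<omega>. (N \<omega>, G j \<omega>)) = distr M (rvec p) N \<Otimes>\<^sub>M \<mu>"
proof -
  interpret prob_space M by (rule prob)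
  have G: "G j \<in> M \<rightarrow>\<^sub>M orth_space p" "distr M (orth_space p) (G j) = \<mu>"
    using draws j by (auto simp: iid_draws_def)
  have "distr M (rvec p \<Otimes>\<^sub>M orth_space p) (\<lambda>\<omega>. (N \<omega>, G j \<omega>)) =
      distr M (rvec p) N \<Otimes>\<^sub>M distr M (orth_space p) (G j)"
  proof (rule distr_pair_eqI[OF noise G(1)])
    fix A B assume A: "A \<in> sets (rvec p)" and B: "B \<in> sets (orth_space p)"
    \<comment> \<open>Independence is given for the whole tuple of draws; an event about draw
      \<open>j\<close> is the preimage of this cylinder set.\<close>
    define B' where "B' = (\<lambda>g. g j) -` B \<inter> space (PiM {1..K} (\<lambda>_. orth_space p))"
    have B': "B' \<in> sets (PiM {1..K} (\<lambda>_. orth_space p))"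
      unfolding B'_def using j B by (intro measurable_sets[OF measurable_component_singleton])
    have "(\<lambda>\<omega>. \<lambda>j\<in>{1..K}. G j \<omega>) \<in> M \<rightarrow>\<^sub>M PiM {1..K} (\<lambda>_. orth_space p)"
      using draws by (intro measurable_restrict) (auto simp: iid_draws_def)
    from measurable_space[OF this]
    have "G j -` B \<inter> space M = (\<lambda>\<omega>. \<lambda>j\<in>{1..K}. G j \<omega>) -` B' \<inter> space M"
      using j by (auto simp: B'_def)
    with A B' draws show "prob ((N -` A \<inter> space M) \<inter> (G j -` B \<inter> space M)) =
        prob (N -` A \<inter> space M) * prob (G j -` B \<inter> space M)"
      by (intro indep_setD) (auto simp: iid_draws_def)
  qed
  then show ?thesis
    by (simp add: G)
qed

text \<open>By Fubini's theorem it suffices to bound the probability for each fixed value of the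
  noise. The observation is then constant, and its rotation by a Haar matrix is spherical.\<close>

lemma prob_linf_norm_rotated_gt:
  assumes prob: "prob_space M"
    and noise: "N \<in> M \<rightarrow>\<^sub>M rvec p"
    and haar: "haar_prob p \<mu>"
    and draws: "iid_draws p K \<mu> M N G"
    and j: "j \<in> {1..K}"
    and "p \<ge> 1" "a > 0"
  shows "measure M {\<omega> \<in> space M. linf_norm p (mat_vec p (G j \<omega>) (vec_add p s (N \<omega>))) >
      a * l2_norm p (vec_add p s (N \<omega>))} \<le> 2 * real p * exp (- (real p * a\<^sup>2 / 2))"
proof -
  interpret prob_space M by (rule prob)
  interpret \<mu>: prob_space \<mu> using haar by (simp add: haar_prob_def)
  have sets_\<mu>: "sets \<mu> = sets (orth_space p)"
    using haar by (simp add: haar_prob_def)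
  define D where "D = distr M (rvec p) N"
  interpret D: prob_space D
    unfolding D_def using noise by (rule prob_space_distr)
  have G: "G j \<in> M \<rightarrow>\<^sub>M orth_space p"
    using draws j by (auto simp: iid_draws_def)
  define S where "S = {z \<in> space (rvec p \<Otimes>\<^sub>M orth_space p).
    a * l2_norm p (vec_add p s (fst z)) < linf_norm p (mat_vec p (snd z) (vec_add p s (fst z)))}"
  have X: "(\<lambda>z. vec_add p s (fst z)) \<in> rvec p \<Otimes>\<^sub>M orth_space p \<rightarrow>\<^sub>M rvec p"
    by (intro measurable_vec_add measurable_fst)
  have S: "S \<in> sets (rvec p \<Otimes>\<^sub>M orth_space p)"
    unfolding S_def
    by (intro borel_measurable_less borel_measurable_times borel_measurable_const
        measurable_compose[OF X measurable_l2_norm]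
        measurable_compose[OF measurable_mat_vec[OF measurable_snd X] measurable_linf_norm])
  have NG: "(\<lambda>\<omega>. (N \<omega>, G j \<omega>)) \<in> M \<rightarrow>\<^sub>M rvec p \<Otimes>\<^sub>M orth_space p"
    using noise G by (rule measurable_Pair)
  define b where "b = 2 * real p * exp (- (real p * a\<^sup>2 / 2))"
  have slice: "emeasure \<mu> (Pair x -` S) \<le> ennreal b" if "x \<in> space D" for x
  proof -
    define y where "y = vec_add p s x"
    have x: "x \<in> space (rvec p)"
      using that by (simp add: D_def)
    have "y \<in> space (rvec p)"
      unfolding y_def by (rule measurable_space[OF measurable_vec_add[OF measurable_ident_sets[OF refl]] x])
    then have sph: "spherical p \<mu> (\<lambda>A. mat_vec p A y)"
      by (rule spherical_haar[OF haar])
    have space_\<mu>: "space \<mu> = orthogonal_group p"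
      using sets_eq_imp_space_eq[OF sets_\<mu>] by (simp add: space_orth_space)
    \<comment> \<open>Rotation preserves the Euclidean norm, so the norm of \<open>y\<close> may be
      replaced by that of the rotated vector, as the tail bound demands.\<close>
    have "Pair x -` S = {A \<in> space \<mu>. linf_norm p (mat_vec p A y) > a * l2_norm p (mat_vec p A y)}"
      using x by (auto simp: S_def y_def space_pair_measure space_\<mu> space_orth_space l2_norm_mat_vec)
    then show ?thesis
      using prob_spherical_linf_norm_gt[OF \<mu>.prob_space_axioms sph assms(6,7)]
      by (simp add: \<mu>.emeasure_eq_measure b_def ennreal_leI)
  qed
  have "emeasure M {\<omega> \<in> space M. linf_norm p (mat_vec p (G j \<omega>) (vec_add p s (N \<omega>))) >
      a * l2_norm p (vec_add p s (N \<omega>))} = emeasure M ((\<lambda>\<omega>. (N \<omega>, G j \<omega>)) -` S \<inter> space M)"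
    using measurable_space[OF NG] by (intro arg_cong[where f = "emeasure M"]) (auto simp: S_def)
  also have "\<dots> = emeasure (distr M (rvec p \<Otimes>\<^sub>M orth_space p) (\<lambda>\<omega>. (N \<omega>, G j \<omega>))) S"
    using NG S by (rule emeasure_distr[symmetric])
  also have "\<dots> = emeasure (D \<Otimes>\<^sub>M \<mu>) S"
    unfolding D_def distr_noise_draw[OF prob noise draws j] ..
  also have "\<dots> = (\<integral>\<^sup>+x. emeasure \<mu> (Pair x -` S) \<partial>D)"
    using S by (intro \<mu>.emeasure_pair_measure_alt) (simp add: D_def sets_\<mu> cong: sets_pair_measure_cong)
  also have "\<dots> \<le> (\<integral>\<^sup>+x. ennreal b \<partial>D)"
    by (intro nn_integral_mono slice)
  also have "\<dots> = ennreal b"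
    by (simp add: D.emeasure_space_1)
  finally show ?thesis
    by (simp add: emeasure_eq_measure b_def)
qed

text \<open>The factor \<open>real K + 1\<close> counts the exceptional events of equal bound: one
  for the noise and one for each draw.\<close>

lemma prob_randomization_rejects_ge:
  assumes prob: "prob_space M"
    and noise: "spherical p M N"
    and haar: "haar_prob p \<mu>"
    and draws: "iid_draws p K \<mu> M N G"
    and level: "0 \<le> \<alpha>" "\<alpha> * (real K + 1) \<ge> 1"
    and "p \<ge> 1" "a > 0"
    and signal: "linf_norm p s > a * (l2_norm p s + 2 * t)"
  shows "measure M {\<omega> \<in> space M. l2_norm p (N \<omega>) \<le> t} -
      (real K + 1) * (2 * real p * exp (- (real p * a\<^sup>2 / 2))) \<le>
    measure M {\<omega> \<in> space M. randomization_rejects \<alpha> K (linf_norm p) (mat_vec p)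
      (\<lambda>j. G j \<omega>) (vec_add p s (N \<omega>))}"
proof -
  interpret prob_space M by (rule prob)
  have N: "N \<in> M \<rightarrow>\<^sub>M rvec p"
    using noise by (simp add: spherical_def)
  define X where "X = (\<lambda>\<omega>. vec_add p s (N \<omega>))"
  define b where "b = 2 * real p * exp (- (real p * a\<^sup>2 / 2))"
  define R where "R = {\<omega> \<in> space M. randomization_rejects \<alpha> K (linf_norm p) (mat_vec p)
      (\<lambda>j. G j \<omega>) (X \<omega>)}"
  define B0 where "B0 = {\<omega> \<in> space M. linf_norm p (N \<omega>) > a * l2_norm p (N \<omega>)}"
  define B where "B = (\<lambda>j. {\<omega> \<in> space M.
    linf_norm p (mat_vec p (G j \<omega>) (X \<omega>)) > a * l2_norm p (X \<omega>)})"
  have X: "X \<in> M \<rightarrow>\<^sub>M rvec p"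
    unfolding X_def using N by (rule measurable_vec_add)
  have GX: "(\<lambda>\<omega>. mat_vec p (G j \<omega>) (X \<omega>)) \<in> M \<rightarrow>\<^sub>M rvec p" if "j \<in> {1..K}" for j
    using draws that X by (intro measurable_mat_vec) (auto simp: iid_draws_def)
  note l2_meas = measurable_compose[OF _ measurable_l2_norm]
  note linf_meas = measurable_compose[OF _ measurable_linf_norm]
  have R: "R \<in> events"
    unfolding R_def
    by (rule measurable_randomization_rejects[OF level(1)])
      (rule linf_meas[OF X], rule linf_meas[OF GX])
  have B0: "B0 \<in> events"
    unfolding B0_def
    by (intro borel_measurable_less borel_measurable_times borel_measurable_const
        l2_meas[OF N] linf_meas[OF N])
  have B: "B j \<in> events" if "j \<in> {1..K}" for j
    unfolding B_def
    by (intro borel_measurable_less borel_measurable_times borel_measurable_const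
        l2_meas[OF X] linf_meas[OF GX[OF that]])
  have UB: "(\<Union>j\<in>{1..K}. B j) \<in> events"
    using B by (intro sets.finite_UN) auto
  \<comment> \<open>Outside the exceptional events, the sup norm of \<open>X \<omega>\<close> is at
    least \<open>linf_norm p s - a * t\<close>, which by \<open>signal\<close> exceeds
    \<open>a * (l2_norm p s + t)\<close> and so every rotated sup norm. One \<open>t\<close> pays
    for the noise in the sup norm, the other for the noise in the Euclidean norm.\<close>
  have "{\<omega> \<in> space M. l2_norm p (N \<omega>) \<le> t} \<subseteq> R \<union> (B0 \<union> (\<Union>j\<in>{1..K}. B j))"
  proof
    fix \<omega> assume "\<omega> \<in> {\<omega> \<in> space M. l2_norm p (N \<omega>) \<le> t}"
    then have \<omega>: "\<omega> \<in> space M" "l2_norm p (N \<omega>) \<le> t"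
      by auto
    show "\<omega> \<in> R \<union> (B0 \<union> (\<Union>j\<in>{1..K}. B j))"
    proof (rule ccontr)
      assume "\<omega> \<notin> R \<union> (B0 \<union> (\<Union>j\<in>{1..K}. B j))"
      then have nR: "\<omega> \<notin> R" and nB0: "linf_norm p (N \<omega>) \<le> a * l2_norm p (N \<omega>)"
        and nB: "\<And>j. j \<in> {1..K} \<Longrightarrow> linf_norm p (mat_vec p (G j \<omega>) (X \<omega>)) \<le> a * l2_norm p (X \<omega>)"
        using \<omega>(1) by (auto simp: B0_def B_def not_less)
      have aN: "a * l2_norm p (N \<omega>) \<le> a * t"
        using \<omega>(2) \<open>a > 0\<close> by simp
      have "a * l2_norm p (X \<omega>) \<le> a * (l2_norm p s + l2_norm p (N \<omega>))"
        using l2_norm_vec_add[of p s "N \<omega>"] \<open>a > 0\<close> by (simp add: X_def)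
      then have aX: "a * l2_norm p (X \<omega>) \<le> a * l2_norm p s + a * t"
        using aN by (simp add: distrib_left)
      have "linf_norm p s \<le> linf_norm p (X \<omega>) + linf_norm p (N \<omega>)"
        unfolding X_def using \<open>p \<ge> 1\<close> by (rule linf_norm_vec_add)
      then have "a * l2_norm p (X \<omega>) < linf_norm p (X \<omega>)"
        using aN aX nB0 signal by (simp add: distrib_left)
      then have "randomization_rejects \<alpha> K (linf_norm p) (mat_vec p) (\<lambda>j. G j \<omega>) (X \<omega>)"
        using nB level(2) by (intro randomization_rejects_if_greatest) (auto intro: le_less_trans)
      then show False
        using nR \<omega>(1) by (simp add: R_def)
    qed
  qed
  then have "prob {\<omega> \<in> space M. l2_norm p (N \<omega>) \<le> t} \<le> prob (R \<union> (B0 \<union> (\<Union>j\<in>{1..K}. B j)))"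
    using R B0 UB by (intro finite_measure_mono sets.Un)
  also have "\<dots> \<le> prob R + (prob B0 + prob (\<Union>j\<in>{1..K}. B j))"
    using R B0 UB by (intro order.trans[OF measure_Un_le] add_left_mono measure_Un_le sets.Un)
  also have "prob B0 \<le> b"
    unfolding B0_def b_def by (rule prob_spherical_linf_norm_gt[OF prob noise assms(7,8)])
  also have "prob (\<Union>j\<in>{1..K}. B j) \<le> (\<Sum>j\<in>{1..K}. prob (B j))"
    using B by (intro measure_UNION_le) auto
  also have "\<dots> \<le> (\<Sum>j\<in>{1..K}. b)"
    unfolding B_def X_def b_def
    by (intro sum_mono prob_linf_norm_rotated_gt[OF prob N haar draws _ assms(7,8)])
  finally have "prob {\<omega> \<in> space M. l2_norm p (N \<omega>) \<le> t} \<le> prob R + (b + real K * b)"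
    by simp
  then show ?thesis
    by (simp add: R_def X_def b_def algebra_simps)
qed

section \<open>Asymptotics and consistency\<close>

text \<open>For \<open>x \<ge> 1\<close> the exponent equals \<open>- (c\<^sup>2 * ln x)\<close>, so
  the expression is a power of \<open>x\<close> with negative exponent
  \<open>1 - c\<^sup>2\<close>.\<close>

lemma tendsto_union_bound:
  fixes c :: real
  assumes "c > 1"
  shows "((\<lambda>x. x * exp (- (x * (c * sqrt (2 * ln x / x))\<^sup>2 / 2))) \<longlongrightarrow> 0) at_top"
proof (rule Lim_transform_eventually)
  have "c\<^sup>2 > 1"
    using assms by (simp add: one_less_power)
  then show "((\<lambda>x. x powr (1 - c\<^sup>2)) \<longlongrightarrow> 0) at_top"
    by (intro tendsto_neg_powr filterlim_ident) simp
  show "\<forall>\<^sub>F x in at_top. x powr (1 - c\<^sup>2) = x * exp (- (x * (c * sqrt (2 * ln x / x))\<^sup>2 / 2))"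
    using eventually_ge_at_top[of 1]
  proof eventually_elim
    case (elim x)
    then have "x * (c * sqrt (2 * ln x / x))\<^sup>2 / 2 = c\<^sup>2 * ln x"
      by (simp add: power_mult_distrib field_simps)
    moreover have "x powr (1 - c\<^sup>2) = exp (ln x) * exp (- (c\<^sup>2 * ln x))"
      using elim by (simp add: powr_def left_diff_distrib exp_diff exp_minus divide_inverse)
    ultimately show ?case
      using elim by simp
  qed
qed

text \<open>
  The quotient cannot exceed 1 through a zero or negative denominator: \<open>x / 0 = 0\<close>, and the
  numerator is nonnegative.
\<close>

lemma linf_norm_gt_of_ratio:
  assumes "p > 1" "c > 0"
    and "c < (linf_norm p s / sqrt (2 * ln (real p))) / (r / sqrt (real p))"
  shows "c * sqrt (2 * ln (real p) / real p) * r < linf_norm p s"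
proof -
  have ln: "sqrt (2 * ln (real p)) > 0" and p: "sqrt (real p) > 0"
    using assms(1) by auto
  have num: "linf_norm p s / sqrt (2 * ln (real p)) \<ge> 0"
    using assms(1) ln linf_norm_nonneg[of p s] by simp
  have "r > 0"
  proof (rule ccontr)
    assume "\<not> r > 0"
    then have "r / sqrt (real p) \<le> 0"
      using p by (intro divide_nonpos_pos) auto
    with num have "(linf_norm p s / sqrt (2 * ln (real p))) / (r / sqrt (real p)) \<le> 0"
      by (rule divide_nonneg_nonpos)
    with assms(2,3) show False by simp
  qed
  then have "c * (r / sqrt (real p)) < linf_norm p s / sqrt (2 * ln (real p))"
    using assms(3) p by (subst (asm) less_divide_eq) auto
  then show ?thesis
    using ln by (simp add: less_divide_eq real_sqrt_divide mult_ac)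
qed

theorem proposition3p3:
  fixes p :: "nat \<Rightarrow> nat"
    and M :: "nat \<Rightarrow> 'a measure"
    and N :: "nat \<Rightarrow> 'a \<Rightarrow> nat \<Rightarrow> real"
    and \<Theta> :: "nat \<Rightarrow> (nat \<Rightarrow> real) set"
    and \<alpha> :: real and K :: nat
    and \<mu> :: "nat \<Rightarrow> (nat \<times> nat \<Rightarrow> real) measure"
    and G :: "nat \<Rightarrow> nat \<Rightarrow> 'a \<Rightarrow> nat \<times> nat \<Rightarrow> real"
  assumes dim_pos: "\<And>m. p m \<ge> 1"
    and dim_tendsto: "filterlim p at_top sequentially"
    and prob: "\<And>m. prob_space (M m)"
    and noise: "\<And>m. spherical (p m) (M m) (N m)"
    and alternatives: "\<And>m. \<Theta> m \<subseteq> space (rvec (p m))"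
    and level: "0 < \<alpha>" "\<alpha> \<le> 1"
    and draws_pos: "K \<ge> 1"
    and level_draws: "\<alpha> * (real K + 1) \<ge> 1"
    and haar: "\<And>m. haar_prob (p m) (\<mu> m)"
    and draws: "\<And>m. iid_draws (p m) K (\<mu> m) (M m) (N m) (G m)"
    and signal: "\<exists>t :: nat \<Rightarrow> real.
        (\<lambda>m. measure (M m) {\<omega> \<in> space (M m). l2_norm (p m) (N m \<omega>) \<le> t m}) \<longlonglongrightarrow> 1 \<and>
        (\<forall>s. (\<forall>m. s m \<in> \<Theta> m) \<longrightarrow>
           liminf (\<lambda>m. ereal
             ((linf_norm (p m) (s m) / sqrt (2 * ln (real (p m)))) /
              ((l2_norm (p m) (s m) + 2 * t m) / sqrt (real (p m))))) > 1)"
  shows "consistent_against M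
           (\<lambda>m s \<omega>. randomization_rejects \<alpha> K (linf_norm (p m)) (mat_vec (p m))
                      (\<lambda>j. G m j \<omega>) (vec_add (p m) s (N m \<omega>)))
           \<Theta>"
proof -
  obtain t :: "nat \<Rightarrow> real" where t:
    "(\<lambda>m. measure (M m) {\<omega> \<in> space (M m). l2_norm (p m) (N m \<omega>) \<le> t m}) \<longlonglongrightarrow> 1"
    and ratio: "\<And>s. (\<And>m. s m \<in> \<Theta> m) \<Longrightarrow> liminf (\<lambda>m. ereal
      ((linf_norm (p m) (s m) / sqrt (2 * ln (real (p m)))) /
       ((l2_norm (p m) (s m) + 2 * t m) / sqrt (real (p m))))) > 1"
    using signal by blast
  show ?thesis
    unfolding consistent_against_def
  proof (intro allI impI)
    fix s assume s: "\<forall>m. s m \<in> \<Theta> m"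
    define rejection where "rejection = (\<lambda>m. measure (M m) {\<omega> \<in> space (M m).
      randomization_rejects \<alpha> K (linf_norm (p m)) (mat_vec (p m))
        (\<lambda>j. G m j \<omega>) (vec_add (p m) (s m) (N m \<omega>))})"
    \<comment> \<open>A constant strictly between 1 and the limit inferior is eventually below the
      ratio, while its excess over 1 makes the error vanish. Density is used in the extended reals
      because the limit inferior may be infinite.\<close>
    obtain c' where c': "1 < c'" "c' < liminf (\<lambda>m. ereal
      ((linf_norm (p m) (s m) / sqrt (2 * ln (real (p m)))) /
       ((l2_norm (p m) (s m) + 2 * t m) / sqrt (real (p m)))))"
      using dense[OF ratio[of s]] s by blast
    then obtain c where c: "c' = ereal c" "c > 1"
      by (cases c') auto
    define a where "a = (\<lambda>x. c * sqrt (2 * ln x / x))"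
    have "\<forall>\<^sub>F m in sequentially. c < (linf_norm (p m) (s m) / sqrt (2 * ln (real (p m)))) /
        ((l2_norm (p m) (s m) + 2 * t m) / sqrt (real (p m)))"
      using less_LiminfD[OF c'(2)] by (simp add: c)
    \<comment> \<open>This makes the logarithm, and hence the threshold \<open>a\<close>,
      positive.\<close>
    moreover have "\<forall>\<^sub>F m in sequentially. p m > 1"
      using filterlim_at_top[THEN iffD1, OF dim_tendsto, THEN spec, of 2] by eventually_elim simp
    ultimately have lower: "\<forall>\<^sub>F m in sequentially.
      measure (M m) {\<omega> \<in> space (M m). l2_norm (p m) (N m \<omega>) \<le> t m} - (real K + 1) *
        (2 * (real (p m) * exp (- (real (p m) * (a (real (p m)))\<^sup>2 / 2)))) \<le> rejection m"
    proof eventually_elim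
      case (elim m)
      have "a (real (p m)) * (l2_norm (p m) (s m) + 2 * t m) < linf_norm (p m) (s m)"
        unfolding a_def using elim c(2) by (intro linf_norm_gt_of_ratio) auto
      moreover have "a (real (p m)) > 0"
        using elim c(2) by (simp add: a_def)
      ultimately show ?case
        using prob_randomization_rejects_ge[OF prob noise haar draws _ level_draws dim_pos]
          level(1) by (simp add: rejection_def mult.assoc)
    qed
    \<comment> \<open>The growth of \<open>p\<close> carries the limit in the real variable
      \<open>x\<close> over to the index \<open>m\<close>.\<close>
    have "(\<lambda>m. real (p m) * exp (- (real (p m) * (a (real (p m)))\<^sup>2 / 2))) \<longlonglongrightarrow> 0"
      unfolding a_def using tendsto_union_bound[OF c(2)]
      by (rule filterlim_compose)
        (rule filterlim_compose[OF filterlim_real_sequentially dim_tendsto])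
    then have "(\<lambda>m. measure (M m) {\<omega> \<in> space (M m). l2_norm (p m) (N m \<omega>) \<le> t m} - (real K + 1) *
        (2 * (real (p m) * exp (- (real (p m) * (a (real (p m)))\<^sup>2 / 2))))) \<longlonglongrightarrow>
        1 - (real K + 1) * (2 * 0)"
      by (intro tendsto_diff tendsto_mult tendsto_const t)
    moreover have "rejection m \<le> 1" for m
      unfolding rejection_def by (rule prob_space.prob_le_1[OF prob])
    ultimately have "rejection \<longlonglongrightarrow> 1"
      using lower by (intro tendsto_sandwich[OF lower _ _ tendsto_const]) auto
    then show "(\<lambda>m. measure (M m) {\<omega> \<in> space (M m).
      randomization_rejects \<alpha> K (linf_norm (p m)) (mat_vec (p m))
        (\<lambda>j. G m j \<omega>) (vec_add (p m) (s m) (N m \<omega>))}) \<longlonglongrightarrow> 1"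
      by (simp add: rejection_def)
  qed
qed

end
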